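(* Let $G$ be a finite group and let $X$ be a $G$-space. Assume that $X$ admits an equivariant $n$-mean $p:X^{n}\to X$ for some multiple $n$ of $|G|$. (1) If $X$ is an ANE, then $X$ is a $G$-ANE. (2) If $X$ is an AE, then $X$ is a $G$-AE.
   Context: All spaces are Hausdorff and "map" means continuous function. A $G$-space is a topological space $X$ with a continuous action $G\times X\to X$ of the Hausdorff topological group $G$ (a finite group is thus discrete). A subset $A$ of a $G$-space is invariant if $ga\in A$ for all $g\in G$, $a\in A$. A $G$-map is a continuous function $f$ between $G$-spaces with $f(gx)=gf(x)$ for all $g,x$. An $n$-mean on a topological space $X$ is a continuous map $p:X^n\to X$ such that $p(x,\dots,x)=x$ for all $x\in X$ and $p(x_1,\dots,x_n)=p(x_{\sigma(1)},\dots,x_{\sigma(n)})$ for all $(x_1,\dots,x_n)\in X^n$ and all permutations $\sigma$ of $\{1,\dots,n\}$. On a $G$-space it is equivariant if $p(gx_1,\dots,gx_n)=g\,p(x_1,\dots,x_n)$ for all $g\in G$ and $(x_1,\dots,x_n)\in X^n$. A $G$-space $Y$ is a $G$-ANE ($G$-absolute neighborhood extensor) if for every metrizable $G$-space $Z$, every closed invariant $A\subseteq Z$ and every $G$-map $f:A\to Y$, there exist an invariant neighborhood $U$ of $A$ in $Z$ and a $G$-map $F:U\to Y$ with $F|_A=f$; if one can always take $U=Z$, then $Y$ is a $G$-AE ($G$-absolute extensor). ANE and AE are these notions for the trivial group. *)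

theory Defs
  imports
    "HOL-Analysis.Analysis"
    "HOL-Algebra.Group_Action"
    "HOL-Algebra.Elementary_Groups"
    "HOL-Combinatorics.Permutations"
begin

locale hausdorff_topological_group = group G for G (structure) +
  fixes T
  assumes topspace_eq_carrier: "topspace T = carrier G"
    and Hausdorff: "Hausdorff_space T"
    and continuous_mult: "continuous_map (prod_topology T T) T (\<lambda>(g, h). g \<otimes> h)"
    and continuous_inv: "continuous_map T T (\<lambda>g. inv g)"

text \<open>As in \<^locale>\<open>group_action\<close>, each \<open>\<phi> g\<close> is an extensional function on the space.\<close>

definition G_space ::
    "('g, 'm) monoid_scheme \<Rightarrow> 'g topology \<Rightarrow> 'x topology \<Rightarrow> ('g \<Rightarrow> 'x \<Rightarrow> 'x) \<Rightarrow> bool" where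
  "G_space G T X \<phi> \<longleftrightarrow>
     hausdorff_topological_group G T \<and> Hausdorff_space X \<and>
     group_action G (topspace X) \<phi> \<and>
     continuous_map (prod_topology T X) X (\<lambda>(g, x). \<phi> g x)"

definition G_invariant ::
    "('g, 'm) monoid_scheme \<Rightarrow> ('g \<Rightarrow> 'x \<Rightarrow> 'x) \<Rightarrow> 'x set \<Rightarrow> bool" where
  "G_invariant G \<phi> A \<longleftrightarrow> (\<forall>g\<in>carrier G. \<forall>a\<in>A. \<phi> g a \<in> A)"

text \<open>The actions are evaluated only at points of \<open>topspace X\<close> and at values of \<open>f\<close>, so for an
  invariant subspace of a \<open>G\<close>-space the action of the ambient space can be used unrestricted.\<close>

definition G_map ::
    "('g, 'm) monoid_scheme \<Rightarrow> 'x topology \<Rightarrow> ('g \<Rightarrow> 'x \<Rightarrow> 'x) \<Rightarrow>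
     'y topology \<Rightarrow> ('g \<Rightarrow> 'y \<Rightarrow> 'y) \<Rightarrow> ('x \<Rightarrow> 'y) \<Rightarrow> bool" where
  "G_map G X \<phi> Y \<psi> f \<longleftrightarrow>
     continuous_map X Y f \<and>
     (\<forall>g\<in>carrier G. \<forall>x\<in>topspace X. f (\<phi> g x) = \<psi> g (f x))"

text \<open>Points of \<open>X\<^sup>n\<close> are the extensional functions \<open>{1..n} \<rightarrow>\<^sub>E topspace X\<close>; they are closed under
  precomposition with a permutation of \<open>{1..n}\<close>.\<close>

definition n_mean :: "nat \<Rightarrow> 'x topology \<Rightarrow> ((nat \<Rightarrow> 'x) \<Rightarrow> 'x) \<Rightarrow> bool" where
  "n_mean n X p \<longleftrightarrow>
     continuous_map (product_topology (\<lambda>_. X) {1..n}) X p \<and>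
     (\<forall>x\<in>topspace X. p (\<lambda>i\<in>{1..n}. x) = x) \<and>
     (\<forall>x\<in>{1..n} \<rightarrow>\<^sub>E topspace X. \<forall>\<sigma>. \<sigma> permutes {1..n} \<longrightarrow> p x = p (x \<circ> \<sigma>))"

definition equivariant_n_mean ::
    "('g, 'm) monoid_scheme \<Rightarrow> nat \<Rightarrow> 'x topology \<Rightarrow> ('g \<Rightarrow> 'x \<Rightarrow> 'x) \<Rightarrow>
     ((nat \<Rightarrow> 'x) \<Rightarrow> 'x) \<Rightarrow> bool" where
  "equivariant_n_mean G n X \<phi> p \<longleftrightarrow>
     n_mean n X p \<and>
     (\<forall>g\<in>carrier G. \<forall>x\<in>{1..n} \<rightarrow>\<^sub>E topspace X. p (\<lambda>i\<in>{1..n}. \<phi> g (x i)) = \<phi> g (p x))"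

text \<open>HOL cannot quantify over all types inside a formula, so the (absolute) extensor properties
  take as a parameter the type \<open>'z\<close> containing the points of the metrizable spaces \<open>Z\<close> to be
  tested. The spaces \<open>Z\<close> have arbitrary subsets of \<open>'z\<close> as underlying sets, and a theorem with a
  free type variable \<open>'z\<close> speaks about metrizable spaces of every size. A neighborhood of \<open>A\<close> is a
  set, not necessarily open, whose interior contains \<open>A\<close>.\<close>

definition G_ANE ::
    "'z itself \<Rightarrow> ('g, 'm) monoid_scheme \<Rightarrow> 'g topology \<Rightarrow> 'y topology \<Rightarrow> ('g \<Rightarrow> 'y \<Rightarrow> 'y) \<Rightarrow> bool"
  where
  "G_ANE (_ :: 'z itself) G T Y \<psi> \<longleftrightarrow>
     G_space G T Y \<psi> \<and>
     (\<forall>(Z :: 'z topology) \<phi> A f.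
        G_space G T Z \<phi> \<and> metrizable_space Z \<and> closedin Z A \<and> G_invariant G \<phi> A \<and>
        G_map G (subtopology Z A) \<phi> Y \<psi> f \<longrightarrow>
        (\<exists>U F. U \<subseteq> topspace Z \<and> A \<subseteq> Z interior_of U \<and> G_invariant G \<phi> U \<and>
           G_map G (subtopology Z U) \<phi> Y \<psi> F \<and> (\<forall>a\<in>A. F a = f a)))"

definition G_AE ::
    "'z itself \<Rightarrow> ('g, 'm) monoid_scheme \<Rightarrow> 'g topology \<Rightarrow> 'y topology \<Rightarrow> ('g \<Rightarrow> 'y \<Rightarrow> 'y) \<Rightarrow> bool"
  where
  "G_AE (_ :: 'z itself) G T Y \<psi> \<longleftrightarrow>
     G_space G T Y \<psi> \<and>
     (\<forall>(Z :: 'z topology) \<phi> A f.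
        G_space G T Z \<phi> \<and> metrizable_space Z \<and> closedin Z A \<and> G_invariant G \<phi> A \<and>
        G_map G (subtopology Z A) \<phi> Y \<psi> f \<longrightarrow>
        (\<exists>F. G_map G Z \<phi> Y \<psi> F \<and> (\<forall>a\<in>A. F a = f a)))"

definition ANE_space :: "'z itself \<Rightarrow> 'y topology \<Rightarrow> bool" where
  "ANE_space z Y \<longleftrightarrow>
     G_ANE z (singleton_group ()) (discrete_topology {()}) Y (\<lambda>_. \<lambda>y\<in>topspace Y. y)"

definition AE_space :: "'z itself \<Rightarrow> 'y topology \<Rightarrow> bool" where
  "AE_space z Y \<longleftrightarrow>
     G_AE z (singleton_group ()) (discrete_topology {()}) Y (\<lambda>_. \<lambda>y\<in>topspace Y. y)"

lemma hausdorff_topological_group_trivial: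
  "hausdorff_topological_group (singleton_group ()) (discrete_topology {()})"
proof -
  have "prod_topology (discrete_topology {()}) (discrete_topology {()})
      = discrete_topology ({()} \<times> {()})"
    by (rule prod_topology_discrete_topology [symmetric])
  then show ?thesis
    by (auto simp: hausdorff_topological_group_def hausdorff_topological_group_axioms_def
      Hausdorff_space_discrete_topology continuous_map_def)
qed

lemma G_space_trivial_iff:
  "G_space (singleton_group ()) (discrete_topology {()}) X \<phi> \<longleftrightarrow>
     Hausdorff_space X \<and> \<phi> = (\<lambda>_. \<lambda>x\<in>topspace X. x)"
proof
  assume "G_space (singleton_group ()) (discrete_topology {()}) X \<phi>"
  then have h: "Hausdorff_space X" and a: "group_action (singleton_group ()) (topspace X) \<phi>"
    by (auto simp: G_space_def)
  have "\<phi> g = (\<lambda>x\<in>topspace X. x)" for g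
    using group_action.id_eq_one[OF a] by (simp add: singleton_group_def)
  with h show "Hausdorff_space X \<and> \<phi> = (\<lambda>_. \<lambda>x\<in>topspace X. x)" by blast
next
  assume r: "Hausdorff_space X \<and> \<phi> = (\<lambda>_. \<lambda>x\<in>topspace X. x)"
  have "(\<lambda>_. \<lambda>x\<in>topspace X. x) \<in> hom (singleton_group ()) (BijGroup (topspace X))"
    by (auto simp: hom_def BijGroup_def id_Bij compose_def singleton_group_def fun_eq_iff)
  then have "group_action (singleton_group ()) (topspace X) (\<lambda>_. \<lambda>x\<in>topspace X. x)"
    by (auto simp: group_action_def group_hom_def group_hom_axioms_def group_BijGroup)
  moreover have "continuous_map (prod_topology (discrete_topology {()}) X) X
      (\<lambda>(g, x). (\<lambda>x\<in>topspace X. x) x)"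
    by (rule continuous_map_eq[OF continuous_map_snd]) auto
  ultimately show "G_space (singleton_group ()) (discrete_topology {()}) X \<phi>"
    using r hausdorff_topological_group_trivial by (auto simp: G_space_def)
qed

lemma trivial_G_map_iff:
  assumes "A \<subseteq> topspace Z"
  shows "G_map (singleton_group ()) (subtopology Z A) (\<lambda>_. \<lambda>x\<in>topspace Z. x)
       Y (\<lambda>_. \<lambda>x\<in>topspace Y. x) f \<longleftrightarrow> continuous_map (subtopology Z A) Y f"
  using assms by (auto simp: G_map_def continuous_map_def Pi_iff topspace_subtopology)

lemma ANE_space_iff:
  "ANE_space (z :: 'z itself) Y \<longleftrightarrow>
     Hausdorff_space Y \<and>
     (\<forall>(Z :: 'z topology) A f.
        metrizable_space Z \<and> closedin Z A \<and> continuous_map (subtopology Z A) Y f \<longrightarrow>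
        (\<exists>U F. U \<subseteq> topspace Z \<and> A \<subseteq> Z interior_of U \<and>
           continuous_map (subtopology Z U) Y F \<and> (\<forall>a\<in>A. F a = f a)))"
proof -
  have inv: "G_invariant (singleton_group ()) (\<lambda>_. \<lambda>x\<in>topspace Z. x) A"
    if "A \<subseteq> topspace Z" for A and Z :: "'z topology"
    using that by (auto simp: G_invariant_def)
  show ?thesis
    unfolding ANE_space_def G_ANE_def G_space_trivial_iff
    using inv trivial_G_map_iff[of _ _ Y] closedin_subset metrizable_imp_Hausdorff_space
    by (smt (verit, best))
qed

lemma AE_space_iff:
  "AE_space (z :: 'z itself) Y \<longleftrightarrow>
     Hausdorff_space Y \<and>
     (\<forall>(Z :: 'z topology) A f.
        metrizable_space Z \<and> closedin Z A \<and> continuous_map (subtopology Z A) Y f \<longrightarrow>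
        (\<exists>F. continuous_map Z Y F \<and> (\<forall>a\<in>A. F a = f a)))"
proof -
  have inv: "G_invariant (singleton_group ()) (\<lambda>_. \<lambda>x\<in>topspace Z. x) A"
    if "A \<subseteq> topspace Z" for A and Z :: "'z topology"
    using that by (auto simp: G_invariant_def)
  have full: "G_map (singleton_group ()) Z (\<lambda>_. \<lambda>x\<in>topspace Z. x)
      Y (\<lambda>_. \<lambda>x\<in>topspace Y. x) f \<longleftrightarrow> continuous_map Z Y f" for Z :: "'z topology" and f
    using trivial_G_map_iff[of "topspace Z" Z Y f] by simp
  show ?thesis
    unfolding AE_space_def G_AE_def G_space_trivial_iff
    using inv trivial_G_map_iff[of _ _ Y] full closedin_subset metrizable_imp_Hausdorff_space
    by (smt (verit, best))
qed

end

theory Submission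
  imports Defs
begin

text \<open>Let \<open>f : A \<rightarrow> X\<close> be a \<open>G\<close>-map on a closed invariant subset of a metrizable \<open>G\<close>-space \<open>Z\<close>.
  Forgetting the action, \<open>f\<close> extends to a continuous map \<open>F\<^sub>0\<close> on \<open>Z\<close>, or on a neighborhood of \<open>A\<close>.
  The mean repairs the missing equivariance. List the elements of \<open>G\<close> as \<open>g\<^sub>1, \<dots>, g\<^sub>n\<close>, each one
  occurring \<open>n / |G|\<close> times, and put
  \<open>F z = p (g\<^sub>1 F\<^sub>0 (g\<^sub>1\<inverse> z), \<dots>, g\<^sub>n F\<^sub>0 (g\<^sub>n\<inverse> z))\<close>.
  Replacing \<open>z\<close> by \<open>h z\<close> replaces the list by its left translate by \<open>h\<inverse>\<close>, up to applying \<open>h\<close> to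
  every argument of \<open>p\<close>. Left translation permutes \<open>G\<close>, hence only reorders the list, so \<open>F\<close> is
  equivariant because \<open>p\<close> is symmetric and equivariant. On \<open>A\<close> all arguments of \<open>p\<close> equal \<open>f z\<close>,
  hence so does \<open>F z\<close>. This is lemma \<open>equivariant_averaging\<close>.

  For the averaging, the domain of \<open>F\<^sub>0\<close> has to be invariant. In the local case it can be shrunk to
  one: as \<open>G\<close> is finite, the intersection of all translates of an open neighborhood of \<open>A\<close> is still
  open (lemma \<open>invariant_open_core\<close>).\<close>

section \<open>Actions on spaces\<close>

lemma G_spaceD:
  assumes "G_space G T Z \<psi>"
  shows G_space_group: "group G"
    and G_space_closed: "\<lbrakk>g \<in> carrier G; z \<in> topspace Z\<rbrakk> \<Longrightarrow> \<psi> g z \<in> topspace Z"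
    and G_space_one: "z \<in> topspace Z \<Longrightarrow> \<psi> \<one>\<^bsub>G\<^esub> z = z"
    and G_space_mult: "\<lbrakk>g \<in> carrier G; h \<in> carrier G; z \<in> topspace Z\<rbrakk> \<Longrightarrow>
      \<psi> (g \<otimes>\<^bsub>G\<^esub> h) z = \<psi> g (\<psi> h z)"
    and G_space_continuous: "g \<in> carrier G \<Longrightarrow> continuous_map Z Z (\<psi> g)"
proof -
  have act: "group_action G (topspace Z) \<psi>"
    and htg: "hausdorff_topological_group G T"
    and cont: "continuous_map (prod_topology T Z) Z (\<lambda>(g, z). \<psi> g z)"
    using assms by (auto simp: G_space_def)
  interpret group_action G "topspace Z" \<psi> by (rule act)
  show "group G"
    using htg by (simp add: hausdorff_topological_group_def)
  show "\<lbrakk>g \<in> carrier G; z \<in> topspace Z\<rbrakk> \<Longrightarrow> \<psi> g z \<in> topspace Z"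
    using element_image by blast
  show "z \<in> topspace Z \<Longrightarrow> \<psi> \<one>\<^bsub>G\<^esub> z = z"
    by (metis id_eq_one restrict_apply')
  show "\<lbrakk>g \<in> carrier G; h \<in> carrier G; z \<in> topspace Z\<rbrakk> \<Longrightarrow> \<psi> (g \<otimes>\<^bsub>G\<^esub> h) z = \<psi> g (\<psi> h z)"
    by (rule composition_rule)
  show "continuous_map Z Z (\<psi> g)" if g: "g \<in> carrier G"
  proof -
    have "g \<in> topspace T"
      using htg g by (simp add: hausdorff_topological_group_def hausdorff_topological_group_axioms_def)
    then have "continuous_map Z (prod_topology T Z) (\<lambda>z. (g, z))"
      by (intro continuous_map_pairedI) auto
    from continuous_map_compose[OF this cont] show ?thesis
      by (simp add: o_def)
  qed
qed

section \<open>Enumerating a finite group with constant multiplicity\<close>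

text \<open>The list of group elements is the first component of a bijection from the indices to
  \<open>G \<times> {0, \<dots>, k - 1}\<close>, where \<open>n = |G| k\<close>; translating the first component then gives an actual
  permutation of the indices.\<close>

lemma (in group) translation_symmetric_enumeration:
  assumes "finite (carrier G)" and "order G dvd n"
  obtains c where "c \<in> {1..n} \<rightarrow> carrier G"
    and "\<And>h. h \<in> carrier G \<Longrightarrow>
      \<exists>\<sigma>. \<sigma> permutes {1..n} \<and> (\<forall>i\<in>{1..n}. c (\<sigma> i) = h \<otimes> c i)"
proof -
  obtain k where n: "n = order G * k"
    using assms(2) by blast
  let ?P = "carrier G \<times> {..<k}"
  have "card {1..n} = card ?P"
    by (simp add: n order_def card_cartesian_product)
  then obtain b where b: "bij_betw b {1..n} ?P"
    using assms(1) by (metis finite_SigmaI finite_atLeastAtMost finite_lessThan finite_same_card_bij)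
  have b_in: "b i \<in> ?P" if "i \<in> {1..n}" for i
    using b that by (auto dest: bij_betwE)
  have "\<exists>\<sigma>. \<sigma> permutes {1..n} \<and> (\<forall>i\<in>{1..n}. fst (b (\<sigma> i)) = h \<otimes> fst (b i))"
    if h: "h \<in> carrier G" for h
  proof -
    define t where "t = map_prod (\<lambda>g. h \<otimes> g) (id :: nat \<Rightarrow> nat)"
    define \<sigma> where "\<sigma> = (\<lambda>i. if i \<in> {1..n} then inv_into {1..n} b (t (b i)) else i)"
    have "bij_betw (\<lambda>g. h \<otimes> g) (carrier G) (carrier G)"
      using h by (simp add: bij_betw_def inj_on_cmult surj_const_mult)
    then have t: "bij_betw t ?P ?P"
      unfolding t_def by (intro bij_betw_map_prod) auto
    have "bij_betw (inv_into {1..n} b \<circ> (t \<circ> b)) {1..n} {1..n}"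
      by (rule bij_betw_trans[OF bij_betw_trans[OF b t] bij_betw_inv_into[OF b]])
    then have "bij_betw \<sigma> {1..n} {1..n}"
      by (rule bij_betw_cong[THEN iffD1, rotated]) (simp add: \<sigma>_def)
    then have "\<sigma> permutes {1..n}"
      by (rule bij_imp_permutes) (simp add: \<sigma>_def del: atLeastAtMost_iff)
    moreover have "fst (b (\<sigma> i)) = h \<otimes> fst (b i)" if i: "i \<in> {1..n}" for i
    proof -
      have "t (b i) \<in> ?P"
        using t b_in[OF i] by (auto dest: bij_betwE)
      then have "b (\<sigma> i) = t (b i)"
        using bij_betw_inv_into_right[OF b] i unfolding \<sigma>_def by (simp only: if_True)
      then show ?thesis
        by (simp add: t_def fst_map_prod)
    qed
    ultimately show ?thesis by blast
  qed
  moreover have "(\<lambda>i. fst (b i)) \<in> {1..n} \<rightarrow> carrier G"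
    using b_in by fastforce
  ultimately show thesis
    using that by blast
qed

section \<open>Averaging over the group\<close>

text \<open>The formula for \<open>F\<close> is the average of the conjugates \<open>z \<mapsto> g (F\<^sub>0 (g\<inverse> z))\<close> of \<open>F\<^sub>0\<close>. Every point
  where \<open>F\<^sub>0\<close> already agrees with an equivariant map on the orbit is left unchanged, since the
  conjugates coincide there. For \<open>n = 0\<close> the argument remains valid: the space \<open>X\<close> then is a single
  point.\<close>

lemma equivariant_averaging:
  fixes G (structure)
  assumes fin: "finite (carrier G)"
    and X: "G_space G T X \<phi>" and Z: "G_space G T Z \<psi>"
    and dvd: "order G dvd n" and p: "equivariant_n_mean G n X \<phi> p"
    and V: "V \<subseteq> topspace Z" "G_invariant G \<psi> V"
    and F0: "continuous_map (subtopology Z V) X F0"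
    and A: "A \<subseteq> V" "G_invariant G \<psi> A"
    and f: "G_map G (subtopology Z A) \<psi> X \<phi> f"
    and ext: "\<forall>a\<in>A. F0 a = f a"
  obtains F where "G_map G (subtopology Z V) \<psi> X \<phi> F" and "\<forall>a\<in>A. F a = f a"
proof -
  interpret group G by (rule G_space_group[OF X])
  obtain c where c: "c \<in> {1..n} \<rightarrow> carrier G"
    and translate: "\<And>h. h \<in> carrier G \<Longrightarrow>
      \<exists>\<sigma>. \<sigma> permutes {1..n} \<and> (\<forall>i\<in>{1..n}. c (\<sigma> i) = h \<otimes> c i)"
    using translation_symmetric_enumeration[OF fin dvd] by blast
  have pcont: "continuous_map (product_topology (\<lambda>_. X) {1..n}) X p"
    and pidem: "\<And>x. x \<in> topspace X \<Longrightarrow> p (\<lambda>i\<in>{1..n}. x) = x"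
    and psym: "\<And>x \<sigma>. x \<in> {1..n} \<rightarrow>\<^sub>E topspace X \<Longrightarrow> \<sigma> permutes {1..n} \<Longrightarrow> p x = p (x \<circ> \<sigma>)"
    and pequi: "\<And>g x. g \<in> carrier G \<Longrightarrow> x \<in> {1..n} \<rightarrow>\<^sub>E topspace X \<Longrightarrow>
      p (\<lambda>i\<in>{1..n}. \<phi> g (x i)) = \<phi> g (p x)"
    using p by (auto simp: equivariant_n_mean_def n_mean_def)
  have topV: "topspace (subtopology Z V) = V" and topA: "topspace (subtopology Z A) = A"
    using V A by auto
  have Vinv: "\<psi> g z \<in> V" if "g \<in> carrier G" "z \<in> V" for g z
    using V that by (auto simp: G_invariant_def)
  have F0_in: "F0 z \<in> topspace X" if "z \<in> V" for z
    using F0 that topV by (auto simp: continuous_map_def)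
  define conj where "conj g z = \<phi> g (F0 (\<psi> (inv g) z))" for g z
  have conj_in: "conj g z \<in> topspace X" if "g \<in> carrier G" "z \<in> V" for g z
    using that by (simp add: conj_def G_space_closed[OF X] F0_in Vinv)
  define orb where "orb z = (\<lambda>i\<in>{1..n}. conj (c i) z)" for z
  have orb_in: "orb z \<in> {1..n} \<rightarrow>\<^sub>E topspace X" if "z \<in> V" for z
    using c that by (auto simp: orb_def intro: conj_in)
  have cont_conj: "continuous_map (subtopology Z V) X (conj g)" if g: "g \<in> carrier G" for g
  proof -
    have "continuous_map (subtopology Z V) (subtopology Z V) (\<psi> (inv g))"
    proof (rule continuous_map_into_subtopology)
      show "continuous_map (subtopology Z V) Z (\<psi> (inv g))"
        using g by (intro continuous_map_from_subtopology G_space_continuous[OF Z]) simp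
      show "\<psi> (inv g) \<in> topspace (subtopology Z V) \<rightarrow> V"
        using g topV by (auto intro: Vinv)
    qed
    from continuous_map_compose[OF continuous_map_compose[OF this F0] G_space_continuous[OF X g]]
    show ?thesis by (simp add: conj_def[abs_def] o_def)
  qed
  have "continuous_map (subtopology Z V) (product_topology (\<lambda>_. X) {1..n}) orb"
    using c by (auto simp: continuous_map_componentwise orb_def Pi_iff intro!: cont_conj)
  from continuous_map_compose[OF this pcont]
  have cont: "continuous_map (subtopology Z V) X (\<lambda>z. p (orb z))"
    by (simp add: o_def)
  have equi: "p (orb (\<psi> h z)) = \<phi> h (p (orb z))" if h: "h \<in> carrier G" and z: "z \<in> V" for h z
  proof -
    obtain \<sigma> where \<sigma>: "\<sigma> permutes {1..n}" and c\<sigma>: "\<And>i. i \<in> {1..n} \<Longrightarrow> c (\<sigma> i) = inv h \<otimes> c i"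
      using translate[of "inv h"] h by auto
    have zZ: "z \<in> topspace Z" using z V by blast
    \<comment> \<open>Moving the point by \<open>h\<close> moves the index \<open>g\<close> of a conjugate to \<open>h\<inverse> g\<close>, at the cost of an
      outer factor \<open>h\<close>; the index shift is absorbed by \<open>\<sigma>\<close>.\<close>
    have conj_shift: "conj g (\<psi> h z) = \<phi> h (conj (inv h \<otimes> g) z)" if g: "g \<in> carrier G" for g
    proof -
      have "inv (inv h \<otimes> g) = inv g \<otimes> h"
        using g h by (simp add: inv_mult_group)
      then have inner: "\<psi> (inv (inv h \<otimes> g)) z = \<psi> (inv g) (\<psi> h z)"
        using g h zZ by (simp add: G_space_mult[OF Z])
      have "F0 (\<psi> (inv g) (\<psi> h z)) \<in> topspace X"
        using g h z by (simp add: F0_in Vinv)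
      then have "\<phi> h (\<phi> (inv h \<otimes> g) (F0 (\<psi> (inv g) (\<psi> h z))))
          = \<phi> (h \<otimes> (inv h \<otimes> g)) (F0 (\<psi> (inv g) (\<psi> h z)))"
        using g h by (simp add: G_space_mult[OF X])
      also have "h \<otimes> (inv h \<otimes> g) = g"
        using g h by (simp add: m_assoc[symmetric])
      finally show ?thesis
        by (simp add: conj_def inner)
    qed
    have "orb (\<psi> h z) = (\<lambda>i\<in>{1..n}. \<phi> h ((orb z \<circ> \<sigma>) i))"
    proof
      fix i
      show "orb (\<psi> h z) i = (\<lambda>i\<in>{1..n}. \<phi> h ((orb z \<circ> \<sigma>) i)) i"
      proof (cases "i \<in> {1..n}")
        case True
        then have "\<sigma> i \<in> {1..n}" using \<sigma> by (simp only: permutes_in_image)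
        with True c show ?thesis
          by (simp add: orb_def conj_shift c\<sigma> Pi_iff del: atLeastAtMost_iff)
      qed (simp add: orb_def del: atLeastAtMost_iff)
    qed
    moreover have "orb z \<circ> \<sigma> \<in> {1..n} \<rightarrow>\<^sub>E topspace X"
      using orb_in[OF z] \<sigma> by (auto simp: PiE_iff extensional_def permutes_in_image
        permutes_not_in simp del: atLeastAtMost_iff)
    ultimately show ?thesis
      using pequi[OF h, of "orb z \<circ> \<sigma>"] psym[OF orb_in[OF z] \<sigma>] by (simp only:)
  qed
  have fixed: "p (orb a) = f a" if a: "a \<in> A" for a
  proof -
    have "conj g a = f a" if g: "g \<in> carrier G" for g
    proof -
      have ga: "\<psi> (inv g) a \<in> A" and aZ: "a \<in> topspace Z"
        using A V a g by (auto simp: G_invariant_def)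
      have "conj g a = f (\<psi> g (\<psi> (inv g) a))"
        using f g ga topA by (simp add: conj_def ext G_map_def)
      also have "\<psi> g (\<psi> (inv g) a) = a"
        using g aZ by (simp add: G_space_mult[OF Z, symmetric] G_space_one[OF Z])
      finally show ?thesis .
    qed
    then have "orb a = (\<lambda>i\<in>{1..n}. f a)"
      using c unfolding orb_def by (intro restrict_ext) (auto simp: Pi_iff)
    moreover have "f a \<in> topspace X"
      using F0_in[of a] bspec[OF ext a] a A by auto
    ultimately show ?thesis by (simp only: pidem)
  qed
  have "G_map G (subtopology Z V) \<psi> X \<phi> (\<lambda>z. p (orb z))"
    using cont equi topV by (auto simp: G_map_def)
  then show thesis
    by (rule that) (simp add: fixed)
qed

section \<open>Invariant neighborhoods and extensors\<close>

text \<open>The set \<open>V\<close> is the intersection of all translates of \<open>W\<close>, which is open because there are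
  only finitely many of them.\<close>

lemma invariant_open_core:
  fixes G (structure)
  assumes fin: "finite (carrier G)" and Z: "G_space G T Z \<psi>"
    and W: "openin Z W" and A: "A \<subseteq> W" "G_invariant G \<psi> A"
  obtains V where "openin Z V" "G_invariant G \<psi> V" "A \<subseteq> V" "V \<subseteq> W"
proof -
  interpret group G by (rule G_space_group[OF Z])
  define V where "V = (\<Inter>g\<in>carrier G. {z \<in> topspace Z. \<psi> g z \<in> W})"
  have "openin Z V"
    unfolding V_def using fin W carrier_not_empty
    by (intro openin_INT2 openin_continuous_map_preimage[OF G_space_continuous[OF Z]]) auto
  moreover have "G_invariant G \<psi> V"
  proof -
    have "\<psi> h (\<psi> g z) \<in> W" if "g \<in> carrier G" "h \<in> carrier G" "z \<in> V" for g h z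
    proof -
      have "z \<in> topspace Z" "\<psi> (h \<otimes> g) z \<in> W"
        using that by (auto simp: V_def)
      then show ?thesis using that by (simp add: G_space_mult[OF Z])
    qed
    moreover have "V \<subseteq> topspace Z"
      by (rule openin_subset[OF \<open>openin Z V\<close>])
    ultimately show ?thesis
      using G_space_closed[OF Z] by (auto simp: G_invariant_def V_def)
  qed
  moreover have "A \<subseteq> V"
    using A openin_subset[OF W] by (auto simp: V_def G_invariant_def)
  moreover have "V \<subseteq> W"
  proof
    fix z assume "z \<in> V"
    then have "z \<in> topspace Z" "\<psi> \<one> z \<in> W"
      by (auto simp: V_def)
    then show "z \<in> W" by (simp add: G_space_one[OF Z])
  qed
  ultimately show thesis by (rule that)
qed

theorem theorem3p2:
  fixes G :: "('g, 'm) monoid_scheme" and T :: "'g topology"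
    and X :: "'x topology" and \<phi> :: "'g \<Rightarrow> 'x \<Rightarrow> 'x"
    and n :: nat and p :: "(nat \<Rightarrow> 'x) \<Rightarrow> 'x"
  assumes "finite (carrier G)"
    and "G_space G T X \<phi>"
    and "order G dvd n"
    and "equivariant_n_mean G n X \<phi> p"
  shows "(ANE_space TYPE('z) X \<longrightarrow> G_ANE TYPE('z) G T X \<phi>) \<and>
         (AE_space TYPE('z) X \<longrightarrow> G_AE TYPE('z) G T X \<phi>)"
proof (intro conjI impI)
  assume ane: "ANE_space TYPE('z) X"
  show "G_ANE TYPE('z) G T X \<phi>"
    unfolding G_ANE_def
  proof (intro conjI allI impI assms(2), elim conjE)
    fix Z :: "'z topology" and \<psi> A f
    assume Z: "G_space G T Z \<psi>" and met: "metrizable_space Z" and cl: "closedin Z A"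
      and A: "G_invariant G \<psi> A" and f: "G_map G (subtopology Z A) \<psi> X \<phi> f"
    have "continuous_map (subtopology Z A) X f"
      using f by (simp add: G_map_def)
    with ane met cl have "\<exists>U F0. U \<subseteq> topspace Z \<and> A \<subseteq> Z interior_of U \<and>
        continuous_map (subtopology Z U) X F0 \<and> (\<forall>a\<in>A. F0 a = f a)"
      by (simp add: ANE_space_iff)
    then obtain U F0 where U: "A \<subseteq> Z interior_of U"
      and F0: "continuous_map (subtopology Z U) X F0" "\<forall>a\<in>A. F0 a = f a"
      by auto
    obtain V where V: "openin Z V" "G_invariant G \<psi> V" "A \<subseteq> V" "V \<subseteq> Z interior_of U"
      by (rule invariant_open_core[OF assms(1) Z openin_interior_of U A])
    have VZ: "V \<subseteq> topspace Z" by (rule openin_subset[OF V(1)])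
    have "V \<subseteq> U" by (rule subset_trans[OF V(4) interior_of_subset])
    then have F0V: "continuous_map (subtopology Z V) X F0"
      using F0(1) by (rule continuous_map_from_subtopology_mono[rotated])
    obtain F where "G_map G (subtopology Z V) \<psi> X \<phi> F" "\<forall>a\<in>A. F a = f a"
      by (rule equivariant_averaging[OF assms(1,2) Z assms(3,4) VZ V(2) F0V V(3) A f F0(2)])
    moreover have "A \<subseteq> Z interior_of V"
      using V(1,3) by (simp add: interior_of_openin)
    ultimately show "\<exists>U F. U \<subseteq> topspace Z \<and> A \<subseteq> Z interior_of U \<and> G_invariant G \<psi> U \<and>
        G_map G (subtopology Z U) \<psi> X \<phi> F \<and> (\<forall>a\<in>A. F a = f a)"
      using VZ V(2) by blast
  qed
next
  assume ae: "AE_space TYPE('z) X"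
  show "G_AE TYPE('z) G T X \<phi>"
    unfolding G_AE_def
  proof (intro conjI allI impI assms(2), elim conjE)
    fix Z :: "'z topology" and \<psi> A f
    assume Z: "G_space G T Z \<psi>" and met: "metrizable_space Z" and cl: "closedin Z A"
      and A: "G_invariant G \<psi> A" and f: "G_map G (subtopology Z A) \<psi> X \<phi> f"
    have "continuous_map (subtopology Z A) X f"
      using f by (simp add: G_map_def)
    with ae met cl have "\<exists>F0. continuous_map Z X F0 \<and> (\<forall>a\<in>A. F0 a = f a)"
      by (simp add: AE_space_iff)
    then obtain F0 where F0: "continuous_map Z X F0" "\<forall>a\<in>A. F0 a = f a"
      by auto
    have inv: "G_invariant G \<psi> (topspace Z)"
      using G_space_closed[OF Z] by (auto simp: G_invariant_def)
    have F0Z: "continuous_map (subtopology Z (topspace Z)) X F0"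
      using F0(1) by simp
    obtain F where "G_map G (subtopology Z (topspace Z)) \<psi> X \<phi> F" "\<forall>a\<in>A. F a = f a"
      by (rule equivariant_averaging[OF assms(1,2) Z assms(3,4) subset_refl inv F0Z
        closedin_subset[OF cl] A f F0(2)])
    then show "\<exists>F. G_map G Z \<psi> X \<phi> F \<and> (\<forall>a\<in>A. F a = f a)"
      by auto
  qed
qed

end
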